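(* There exist positive constants $a$ and $b$ such that for all sufficiently large $n$, $$a\sqrt{n}\le\chi'_{C_4}(n)\le b\sqrt{n}\log n.$$
   Context: For a graph $G$ and a set $\mathcal H$ of small graphs, an $\mathcal H$-avoiding bipartite partition of $G$ is a collection of bipartite graphs $G_1,\dots,G_k$ (subgraphs of $G$) whose edge sets are pairwise disjoint with union $E(G)$, such that no $G_i$ contains any member of $\mathcal H$ as an induced subgraph. $\chi'_{\mathcal H}(G)$ is the smallest $k$ for which such a partition with $k$ graphs exists, and $\chi'_{\mathcal H}(n):=\chi'_{\mathcal H}(K_n)$, where $K_n$ is the complete graph on $n$ vertices; for $\mathcal H=\{H\}$ one writes $\chi'_H$. $C_4$ is the cycle on 4 vertices. *)

theory Defs
  imports Complex_Main
begin

text \<open>A graph is a pair of a vertex set and a set of edges, an edge being a two-element set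
  of vertices.\<close>

type_synonym 'a graph = "'a set \<times> 'a set set"

abbreviation verts :: "'a graph \<Rightarrow> 'a set" where
  "verts G \<equiv> fst G"

abbreviation edges :: "'a graph \<Rightarrow> 'a set set" where
  "edges G \<equiv> snd G"

definition simple_graph :: "'a graph \<Rightarrow> bool" where
  "simple_graph G \<longleftrightarrow> finite (verts G) \<and> (\<forall>e\<in>edges G. e \<subseteq> verts G \<and> card e = 2)"

definition subgraph :: "'a graph \<Rightarrow> 'a graph \<Rightarrow> bool" where
  "subgraph H G \<longleftrightarrow> simple_graph H \<and> verts H \<subseteq> verts G \<and> edges H \<subseteq> edges G"

definition bipartite :: "'a graph \<Rightarrow> bool" where
  "bipartite G \<longleftrightarrow>
     (\<exists>A B. A \<union> B = verts G \<and> A \<inter> B = {} \<and> (\<forall>e\<in>edges G. \<exists>a\<in>A. \<exists>b\<in>B. e = {a, b}))"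

definition induced_subgraph :: "'a graph \<Rightarrow> 'a set \<Rightarrow> 'a graph" where
  "induced_subgraph G S = (S, {e \<in> edges G. e \<subseteq> S})"

definition graph_iso :: "'a graph \<Rightarrow> 'b graph \<Rightarrow> bool" where
  "graph_iso G H \<longleftrightarrow>
     (\<exists>f. bij_betw f (verts G) (verts H) \<and> (\<lambda>e. f ` e) ` edges G = edges H)"

definition contains_induced :: "'a graph \<Rightarrow> 'b graph \<Rightarrow> bool" where
  "contains_induced G H \<longleftrightarrow> (\<exists>S\<subseteq>verts G. graph_iso H (induced_subgraph G S))"

definition avoiding_bipartite_partition ::
    "'b graph set \<Rightarrow> 'a graph \<Rightarrow> nat \<Rightarrow> (nat \<Rightarrow> 'a graph) \<Rightarrow> bool" where
  "avoiding_bipartite_partition \<H> G k P \<longleftrightarrow>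
     (\<forall>i\<in>{1..k}. subgraph (P i) G \<and> bipartite (P i) \<and>
        (\<forall>H\<in>\<H>. \<not> contains_induced (P i) H)) \<and>
     (\<forall>i\<in>{1..k}. \<forall>j\<in>{1..k}. i \<noteq> j \<longrightarrow> edges (P i) \<inter> edges (P j) = {}) \<and>
     (\<Union>i\<in>{1..k}. edges (P i)) = edges G"

text \<open>The value is meaningful only if some partition exists. This is the case whenever no member
  of the family is an induced subgraph of a single edge: take the edges of \<open>G\<close> one by one.\<close>

definition avoiding_index :: "'b graph set \<Rightarrow> 'a graph \<Rightarrow> nat" where
  "avoiding_index \<H> G = (LEAST k. \<exists>P. avoiding_bipartite_partition \<H> G k P)"

definition complete_graph :: "nat \<Rightarrow> nat graph" where
  "complete_graph n = ({..<n}, {e. e \<subseteq> {..<n} \<and> card e = 2})"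

definition C4 :: "nat graph" where
  "C4 = ({0, 1, 2, 3}, {{0, 1}, {1, 2}, {2, 3}, {3, 0}})"

end

theory Submission
  imports Defs "HOL-Algebra.Algebraic_Closure_Type" "HOL-Library.Z2"
begin

text \<open>
  A bipartite graph contains an induced \<open>C\<^sub>4\<close> iff it contains any \<open>C\<^sub>4\<close>.
  Lower bound: counting paths of length two shows that a \<open>C\<^sub>4\<close>-free graph on \<open>n\<close> vertices has at
  most \<open>n powr (3/2)\<close> edges.
  Upper bound: identify the vertices with distinct points \<open>(x, y)\<close> of \<open>F \<times> F\<close>, where \<open>F\<close> is a field
  of order \<open>q = 2 ^ k\<close> and \<open>q\<^sup>2\<close> is of order \<open>n\<close>. Colour an edge \<open>{u, v}\<close> by the pair of the least
  binary digit in which \<open>u\<close> and \<open>v\<close> differ and \<open>y\<^sub>u + y\<^sub>v + x\<^sub>u x\<^sub>v\<close>. The digit makes every colour class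
  bipartite, and two distinct vertices have at most one common neighbour for a given value of
  the second component. This uses \<open>O(q log n)\<close> colours.
\<close>

section \<open>Four-cycles\<close>

text \<open>Chords are allowed, so this is a not necessarily induced cycle. Distinctness is demanded
  only of opposite vertices; neighbours differ because edges of a simple graph have two
  elements.\<close>

definition four_cycle :: "'a graph \<Rightarrow> 'a \<Rightarrow> 'a \<Rightarrow> 'a \<Rightarrow> 'a \<Rightarrow> bool" where
  "four_cycle G a b c d \<longleftrightarrow> a \<noteq> c \<and> b \<noteq> d \<and>
     {a, b} \<in> edges G \<and> {b, c} \<in> edges G \<and> {c, d} \<in> edges G \<and> {d, a} \<in> edges G"

lemma contains_induced_C4_imp_four_cycle:
  assumes "contains_induced G C4"
  shows "\<exists>a b c d. four_cycle G a b c d"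
proof -
  obtain S f where "bij_betw f {0, 1, 2, 3 :: nat} S"
    and im: "(\<lambda>e. f ` e) ` {{0, 1}, {1, 2}, {2, 3}, {3, 0 :: nat}} = {e \<in> edges G. e \<subseteq> S}"
    using assms by (auto simp: contains_induced_def graph_iso_def induced_subgraph_def C4_def)
  then have "inj_on f {0, 1, 2, 3}" by (simp add: bij_betw_def)
  then have "f 0 \<noteq> f 2" "f 1 \<noteq> f 3" by (auto simp: inj_on_def)
  moreover have "f ` e \<in> edges G" if "e \<in> {{0, 1}, {1, 2}, {2, 3}, {3, 0}}" for e
    using im that by blast
  from this[of "{0, 1}"] this[of "{1, 2}"] this[of "{2, 3}"] this[of "{3, 0}"]
  have "{f 0, f 1} \<in> edges G" "{f 1, f 2} \<in> edges G" "{f 2, f 3} \<in> edges G"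
    "{f 3, f 0} \<in> edges G" by simp_all
  ultimately have "four_cycle G (f 0) (f 1) (f 2) (f 3)"
    by (simp add: four_cycle_def)
  then show ?thesis by blast
qed

text \<open>Opposite vertices of a four-cycle lie on the same side of the bipartition, so neither
  chord can be an edge.\<close>

lemma four_cycle_imp_contains_induced_C4:
  assumes G: "simple_graph G" "bipartite G" and cyc: "four_cycle G a b c d"
  shows "contains_induced G C4"
proof -
  have E: "{a, b} \<in> edges G" "{b, c} \<in> edges G" "{c, d} \<in> edges G" "{d, a} \<in> edges G"
    and ne: "a \<noteq> c" "b \<noteq> d"
    using cyc by (auto simp: four_cycle_def)
  have card2: "card e = 2" "e \<subseteq> verts G" if "e \<in> edges G" for e
    using G(1) that by (auto simp: simple_graph_def)
  have ne': "a \<noteq> b" "b \<noteq> c" "c \<noteq> d" "d \<noteq> a"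
    using card2(1)[OF E(1)] card2(1)[OF E(2)] card2(1)[OF E(3)] card2(1)[OF E(4)]
    by (auto simp: card_insert_if)
  obtain A B where AB: "A \<inter> B = {}" "\<forall>e\<in>edges G. \<exists>a\<in>A. \<exists>b\<in>B. e = {a, b}"
    using G(2) by (auto simp: bipartite_def)
  have side: "(u \<in> A \<and> v \<in> B) \<or> (u \<in> B \<and> v \<in> A)" if "{u, v} \<in> edges G" for u v
    using AB(2)[rule_format, OF that] by (auto simp: doubleton_eq_iff)
  have nE: "{a, c} \<notin> edges G" "{b, d} \<notin> edges G"
    using side[OF E(1)] side[OF E(2)] side[OF E(3)] side[of a c] side[of b d] AB(1) by blast+
  define f :: "nat \<Rightarrow> 'a" where
    "f i = (if i = 0 then a else if i = 1 then b else if i = 2 then c else d)" for i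
  have bij: "bij_betw f {0, 1, 2, 3} {a, b, c, d}"
    using ne ne' by (auto simp: bij_betw_def inj_on_def f_def)
  have "e \<in> {{a, b}, {b, c}, {c, d}, {d, a}}" if e: "e \<in> edges G" "e \<subseteq> {a, b, c, d}" for e
  proof -
    obtain u v where uv: "e = {u, v}" "u \<noteq> v"
      using card2(1)[OF e(1)] by (auto simp: card_2_iff)
    have "u \<in> {a, b, c, d}" "v \<in> {a, b, c, d}"
      using e(2) unfolding uv(1) by simp_all
    moreover have "{u, v} \<noteq> {a, c}" "{u, v} \<noteq> {b, d}"
      using e(1) nE unfolding uv(1) by metis+
    ultimately show ?thesis
      unfolding uv(1) using uv(2) by (elim insertE emptyE) (simp_all add: insert_commute)
  qed
  then have ind: "{e \<in> edges G. e \<subseteq> {a, b, c, d}} = {{a, b}, {b, c}, {c, d}, {d, a}}"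
    using E by auto
  have sub: "{a, b, c, d} \<subseteq> verts G"
    using card2(2)[OF E(1)] card2(2)[OF E(3)] by auto
  have "graph_iso C4 (induced_subgraph G {a, b, c, d})"
    unfolding graph_iso_def induced_subgraph_def C4_def fst_conv snd_conv ind
    by (rule exI[of _ f], rule conjI[OF bij]) (simp add: f_def insert_commute)
  then show ?thesis using sub unfolding contains_induced_def by blast
qed

section \<open>Lower bound\<close>

text \<open>\<open>D\<close> consists of ordered pairs, so every edge counts twice and
  \<open>card D\<close> is the degree sum.\<close>

lemma four_cycle_free_arcs_bound:
  fixes G :: "'a graph"
  assumes G: "simple_graph G" "verts G \<subseteq> V" and V: "finite V"
    and free: "\<And>a b c d. \<not> four_cycle G a b c d"
  defines "D \<equiv> {(u, v). {u, v} \<in> edges G}"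
  shows "real (card D) \<le> 2 * real (card V) * sqrt (real (card V))"
proof -
  define N where "N v = {u. {v, u} \<in> edges G}" for v
  define m where "m = (\<Sum>v\<in>V. real (card (N v)))"
  define n where "n = real (card V)"
  have edge: "u \<in> V" "v \<in> V" if "{u, v} \<in> edges G" for u v
    using G that by (auto 4 4 simp: simple_graph_def)
  have NV: "N v \<subseteq> V" for v
    using edge by (auto simp: N_def)
  have fin [simp]: "finite (N v)" for v
    using NV V by (rule finite_subset)
  have D: "D = Sigma V N"
    using edge by (auto simp: N_def D_def)
  have m: "real (card D) = m"
    unfolding D m_def using V by (simp add: card_SigmaI)
  \<comment> \<open>The sum counts triples \<open>(v, u, w)\<close> with \<open>u\<close> and
    \<open>w\<close> neighbours of \<open>v\<close>; the degenerate ones with \<open>u = w\<close>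
    are the arcs.\<close>
  have "(\<Sum>v\<in>V. card (N v) ^ 2) = card (SIGMA v:V. N v \<times> N v)"
    using V by (simp add: card_SigmaI card_cartesian_product power2_eq_square)
  also have "(SIGMA v:V. N v \<times> N v) =
      {(v, u, w). v \<in> V \<and> u \<in> N v \<and> w \<in> N v \<and> u \<noteq> w} \<union> (\<lambda>(v, u). (v, u, u)) ` Sigma V N"
    (is "_ = ?T \<union> ?U") by auto
  also have "card (?T \<union> ?U) \<le> card ?T + card ?U"
    by (rule card_Un_le)
  also have "card ?U \<le> card D"
    unfolding D using V by (intro card_image_le) auto
  \<comment> \<open>Two common neighbours \<open>v\<close>, \<open>v'\<close> of distinct
    \<open>u\<close>, \<open>w\<close> would give the cycle \<open>u v w v'\<close>, so forgetting
    the centre is injective on \<open>?T\<close>.\<close>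
  also have "card ?T \<le> card (V \<times> V)"
  proof (rule card_inj_on_le)
    have "v = v'" if "u \<in> N v" "w \<in> N v" "u \<in> N v'" "w \<in> N v'" "u \<noteq> w" for v v' u w
      using free[of u v w v'] that by (auto simp: N_def four_cycle_def insert_commute)
    then show "inj_on snd ?T" by (auto simp: inj_on_def)
    show "snd ` ?T \<subseteq> V \<times> V" using subsetD[OF NV] by auto
    show "finite (V \<times> V)" using V by simp
  qed
  finally have "(\<Sum>v\<in>V. card (N v) ^ 2) \<le> card V * card V + card D"
    by (simp add: card_cartesian_product)
  then have "real (\<Sum>v\<in>V. card (N v) ^ 2) \<le> real (card V * card V + card D)"
    by (rule of_nat_mono)
  then have sq: "(\<Sum>v\<in>V. real (card (N v)) ^ 2) \<le> n * n + m"
    by (simp add: m n_def)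
  \<comment> \<open>Expanding squares around \<open>sqrt n\<close>, the expected order of the
    degrees, takes the place of Cauchy-Schwarz.\<close>
  have "0 \<le> (\<Sum>v\<in>V. (real (card (N v)) - sqrt n)\<^sup>2)"
    by (intro sum_nonneg) simp
  also have "\<dots> = (\<Sum>v\<in>V. (real (card (N v)))\<^sup>2) - 2 * sqrt n * m + n * n"
    by (simp add: power2_diff sum.distrib sum_subtractf m_def sum_distrib_left mult_ac n_def)
  finally have "2 * sqrt n * m \<le> 2 * n * n + m"
    using sq by simp
  \<comment> \<open>This absorbs the term \<open>m\<close> contributed by the degenerate
    triples.\<close>
  moreover have "m \<le> sqrt n * m"
  proof (cases "card V = 0")
    case True
    then show ?thesis using V by (simp add: m_def)
  next
    case False
    then have "1 \<le> sqrt n" by (simp add: n_def)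
    moreover have "0 \<le> m" by (simp add: m_def sum_nonneg)
    ultimately show ?thesis using mult_right_mono[of 1 "sqrt n" m] by simp
  qed
  ultimately have "sqrt n * m \<le> 2 * n * n" by simp
  also have "\<dots> = sqrt n * (2 * n * sqrt n)" by (simp add: n_def)
  finally have "sqrt n * m \<le> sqrt n * (2 * n * sqrt n)" .
  then have "m \<le> 2 * n * sqrt n"
    using V by (cases "card V = 0") (auto simp: n_def m_def)
  then show ?thesis by (simp add: m n_def)
qed

text \<open>The \<open>n * n\<close> ordered pairs are covered by the diagonal and the arcs of the
  \<open>k\<close> parts, each part having at most \<open>2 * n * sqrt n\<close> arcs.\<close>

lemma avoiding_partition_lower_bound:
  assumes P: "avoiding_bipartite_partition {C4} (complete_graph n) k P" and n: "n \<ge> 2"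
  shows "sqrt (real n) / 4 \<le> real k"
proof -
  define D where "D i = {(u, v). {u, v} \<in> edges (P i)}" for i
  have un: "(\<Union>i\<in>{1..k}. edges (P i)) = {e. e \<subseteq> {..<n} \<and> card e = 2}"
    using P by (simp add: avoiding_bipartite_partition_def complete_graph_def)
  have D: "real (card (D i)) \<le> 2 * real n * sqrt (real n)" if "i \<in> {1..k}" for i
  proof -
    have *: "subgraph (P i) (complete_graph n)" "bipartite (P i)" "\<not> contains_induced (P i) C4"
      using P that by (auto simp: avoiding_bipartite_partition_def)
    then have simp: "simple_graph (P i)" "verts (P i) \<subseteq> {..<n}"
      by (auto simp: subgraph_def complete_graph_def)
    then have "\<not> four_cycle (P i) a b c d" for a b c d
      using four_cycle_imp_contains_induced_C4[OF simp(1) *(2)] *(3) by (intro notI) simp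
    from four_cycle_free_arcs_bound[OF simp _ this] show ?thesis
      by (simp add: D_def)
  qed
  have "{..<n} \<times> {..<n} = (\<Union>i\<in>{1..k}. D i) \<union> (\<lambda>u. (u, u)) ` {..<n}" (is "_ = ?W \<union> ?I")
  proof -
    have "(\<exists>i\<in>{1..k}. (u, v) \<in> D i) \<longleftrightarrow> u < n \<and> v < n \<and> u \<noteq> v" for u v
    proof -
      have "(\<exists>i\<in>{1..k}. (u, v) \<in> D i) \<longleftrightarrow> {u, v} \<in> (\<Union>i\<in>{1..k}. edges (P i))"
        by (simp add: D_def)
      also have "\<dots> \<longleftrightarrow> u < n \<and> v < n \<and> u \<noteq> v"
        unfolding un by (cases "u = v") auto
      finally show ?thesis .
    qed
    then show ?thesis by auto
  qed
  then have "n * n = card (?W \<union> ?I)"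
    by (metis card_cartesian_product card_lessThan)
  also have "\<dots> \<le> card ?W + card ?I"
    by (rule card_Un_le)
  also have "\<dots> \<le> (\<Sum>i\<in>{1..k}. card (D i)) + n"
    using card_UN_le[of "{1..k}" D] card_image_le[of "{..<n}" "\<lambda>u. (u, u)"] by simp
  finally have "real (n * n) \<le> real ((\<Sum>i\<in>{1..k}. card (D i)) + n)"
    by (rule of_nat_mono)
  also have "\<dots> = (\<Sum>i\<in>{1..k}. real (card (D i))) + n" by simp
  also have "(\<Sum>i\<in>{1..k}. real (card (D i))) \<le> (\<Sum>i\<in>{1..k}. 2 * real n * sqrt (real n))"
    by (intro sum_mono D)
  finally have "real n * real n \<le> real n * (2 * (real k * sqrt (real n)) + 1)"
    by (simp add: algebra_simps)
  then have "real n \<le> 2 * (real k * sqrt (real n)) + 1"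
    using n by simp
  \<comment> \<open>Since \<open>n \<ge> 2\<close>, the 1 coming from the diagonal is at most
    \<open>n / 2\<close>; this leads to the constant 1/4.\<close>
  then have "real n / 2 \<le> 2 * (real k * sqrt (real n))"
    using n by simp
  then have "sqrt (real n) * sqrt (real n) \<le> (4 * real k) * sqrt (real n)"
    by simp
  then have "sqrt (real n) \<le> 4 * real k"
    by (rule mult_right_le_imp_le) (use n in auto)
  then show ?thesis by simp
qed

section \<open>Finite fields of characteristic two\<close>

text \<open>The polynomial splits into linear factors, and a repeated factor would make the
  derivative vanish at its root; so all multiplicities are 1.\<close>

lemma card_roots_eq_degree:
  fixes p :: "'a :: alg_closed_field poly"
  assumes p: "p \<noteq> 0" and sep: "\<And>a. poly p a = 0 \<Longrightarrow> poly (pderiv p) a \<noteq> 0"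
  shows "card {a. poly p a = 0} = degree p"
proof -
  obtain A where A: "size A = degree p" "p = smult (lead_coeff p) (\<Prod>x\<in>#A. [:-x, 1:])"
    using alg_closed_imp_factorization[OF p] by blast
  have cnt: "count A a = 1" if a: "a \<in># A" for a
  proof (rule ccontr)
    assume "count A a \<noteq> 1"
    moreover obtain B where B: "A = add_mset a B"
      using multi_member_split[OF a] by blast
    ultimately have "count B a \<noteq> 0" by simp
    then have "a \<in># B" by (simp add: count_eq_zero_iff)
    from multi_member_split[OF this] obtain C where "B = add_mset a C" by blast
    then have "A = add_mset a (add_mset a C)" using B by simp
    moreover define r where "r = smult (lead_coeff p) (\<Prod>x\<in>#C. [:-x, 1:])"
    ultimately have r: "p = [:-a, 1:] * ([:-a, 1:] * r)"
      by (subst A(2)) simp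
    have "poly p a = 0" unfolding r by simp
    moreover have "poly (pderiv p) a = 0"
      unfolding r pderiv_mult by simp
    ultimately show False using sep by blast
  qed
  have "poly p a = 0 \<longleftrightarrow> a \<in># A" for a
    by (subst A(2)) (use p in \<open>auto simp: poly_prod_mset prod_mset_zero_iff\<close>)
  then have "{a. poly p a = 0} = set_mset A" by auto
  moreover have "size A = (\<Sum>a\<in>set_mset A. 1)"
    unfolding size_multiset_overloaded_eq using cnt by (intro sum.cong) auto
  ultimately show ?thesis using A(1) by simp
qed

lemma CHAR_bit: "CHAR(bit) = 2"
proof (rule CHAR_eqI)
  show "of_nat 2 = (0 :: bit)" by simp
next
  fix n assume "of_nat n = (0 :: bit)"
  then have "even (of_nat n :: bit)" by simp
  then show "2 dvd n" by (simp only: even_of_nat_iff)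
qed

text \<open>This set is the field of order \<open>2 ^ k\<close> inside the algebraic closure,
  obtained as the roots of \<open>X ^ (2 ^ k) - X\<close>.\<close>

lemma card_frobenius_fixed:
  assumes "k > 0"
  shows "card {x :: bit alg_closure. x ^ (2 ^ k) = x} = 2 ^ k"
proof -
  define p :: "bit alg_closure poly" where "p = monom 1 (2 ^ k) + monom (- 1) 1"
  have gt: "(2 :: nat) ^ k > 1" using assms by (intro one_less_power) simp_all
  have deg: "degree p = 2 ^ k"
    unfolding p_def using gt by (subst degree_add_eq_left) (auto simp: degree_monom_eq)
  have two: "(2 :: bit alg_closure) = 0"
    using to_ac_numeral[where 'a = bit] by (metis bit_2_eq_0 to_ac_0)
  \<comment> \<open>The leading term differentiates to a multiple of \<open>2 ^ k\<close>, which is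
    zero in characteristic two because \<open>k > 0\<close>.\<close>
  have "pderiv p = - 1"
    using assms by (simp add: p_def pderiv_add pderiv_monom two power_0_left monom_0 one_pCons)
  then have "poly (pderiv p) a \<noteq> 0" for a by simp
  moreover have "p \<noteq> 0" using deg by auto
  ultimately have "card {a. poly p a = 0} = degree p"
    by (intro card_roots_eq_degree)
  then show ?thesis by (simp add: deg) (simp add: p_def poly_monom)
qed

text \<open>Makes the set of Frobenius fixed points closed under addition.\<close>

lemma frobenius_add:
  fixes x y :: "bit alg_closure"
  shows "(x + y) ^ (2 ^ k) = x ^ (2 ^ k) + y ^ (2 ^ k)"
  by (rule freshmans_dream'[where n = k]) (simp_all add: CHAR_bit)

section \<open>Upper bound\<close>

text \<open>Reduces the upper bound to an edge colouring whose classes are bipartite and free of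
  four-cycles. A colour in \<open>C\<close> that never occurs yields an edgeless part, so exactly
  \<open>card C\<close> parts arise.\<close>

lemma avoiding_partition_of_colouring:
  fixes col :: "nat \<Rightarrow> nat \<Rightarrow> 'c"
  assumes C: "finite C" "\<And>u v. u < n \<Longrightarrow> v < n \<Longrightarrow> u \<noteq> v \<Longrightarrow> col u v \<in> C"
    and sym: "\<And>u v. col u v = col v u"
    and bip: "\<And>t. t \<in> C \<Longrightarrow> \<exists>A. \<forall>u<n. \<forall>v<n. u \<noteq> v \<longrightarrow> col u v = t \<longrightarrow> (u \<in> A) \<noteq> (v \<in> A)"
    and free: "\<And>a b c d. \<lbrakk>a < n; b < n; c < n; d < n; a \<noteq> c; b \<noteq> d;
                 col a b = col b c; col b c = col c d; col c d = col d a\<rbrakk> \<Longrightarrow> False"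
  shows "\<exists>P. avoiding_bipartite_partition {C4} (complete_graph n) (card C) P"
proof -
  obtain h where h: "bij_betw h {1..card C} C"
    using finite_same_card_bij[of "{1..card C}" C] C(1) by auto
  define E where "E t = {{u, v} | u v. u < n \<and> v < n \<and> u \<noteq> v \<and> col u v = t}" for t
  define P where "P i = ({..<n}, E (h i))" for i
  have E_iff: "{u, v} \<in> E t \<longleftrightarrow> u < n \<and> v < n \<and> u \<noteq> v \<and> col u v = t" for u v t
    unfolding E_def using sym by (auto simp: doubleton_eq_iff)
  have hC: "h i \<in> C" if "i \<in> {1..card C}" for i
    using h that by (auto simp: bij_betw_def)
  have sub: "subgraph (P i) (complete_graph n)" for i
    by (auto simp: subgraph_def simple_graph_def complete_graph_def P_def E_def)
  have bipP: "bipartite (P i)" if i: "i \<in> {1..card C}" for i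
  proof -
    obtain A where A: "\<forall>u<n. \<forall>v<n. u \<noteq> v \<longrightarrow> col u v = h i \<longrightarrow> (u \<in> A) \<noteq> (v \<in> A)"
      using bip[OF hC[OF i]] by blast
    have "\<exists>a\<in>{..<n} \<inter> A. \<exists>b\<in>{..<n} - A. e = {a, b}" if e: "e \<in> E (h i)" for e
    proof -
      obtain u v where uv: "e = {u, v}" "u < n" "v < n" "u \<noteq> v" "col u v = h i"
        using e by (auto simp: E_def)
      then have "(u \<in> A) \<noteq> (v \<in> A)" using A by blast
      then show ?thesis using uv by (cases "u \<in> A") (auto simp: insert_commute)
    qed
    then show ?thesis
      unfolding bipartite_def P_def fst_conv snd_conv
      by (intro exI[of _ "{..<n} \<inter> A"] exI[of _ "{..<n} - A"]) auto
  qed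
  have freeP: "\<not> contains_induced (P i) C4" for i
  proof
    assume "contains_induced (P i) C4"
    then obtain a b c d where "four_cycle (P i) a b c d"
      using contains_induced_C4_imp_four_cycle by blast
    then show False
      using free[of a b c d] by (auto simp: four_cycle_def P_def E_iff)
  qed
  have disj: "edges (P i) \<inter> edges (P j) = {}"
    if "i \<in> {1..card C}" "j \<in> {1..card C}" "i \<noteq> j" for i j
  proof -
    have "h i \<noteq> h j" using bij_betw_imp_inj_on[OF h] that by (simp add: inj_on_eq_iff)
    moreover have "h i = h j" if e: "e \<in> E (h i)" "e \<in> E (h j)" for e
    proof -
      obtain u v where "e = {u, v}" using e(1) by (auto simp: E_def)
      then show ?thesis using e E_iff by metis
    qed
    ultimately show ?thesis by (auto simp: P_def)
  qed
  have "(\<Union>i\<in>{1..card C}. edges (P i)) = (\<Union>t\<in>h ` {1..card C}. E t)"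
    by (simp add: P_def)
  also have "\<dots> = (\<Union>t\<in>C. E t)"
    using h by (simp add: bij_betw_def)
  also have "\<dots> = edges (complete_graph n)"
    using C(2) by (auto simp: E_def complete_graph_def card_2_iff) blast
  finally have "(\<Union>i\<in>{1..card C}. edges (P i)) = edges (complete_graph n)" .
  then have "avoiding_bipartite_partition {C4} (complete_graph n) (card C) P"
    unfolding avoiding_bipartite_partition_def using sub bipP freeP disj by blast
  then show ?thesis by (intro exI[of _ P])
qed

section \<open>The colouring by binary digits and field elements\<close>

lemma ex_bit_neq:
  fixes u v :: nat
  assumes "u \<noteq> v" "u < 2 ^ L" "v < 2 ^ L"
  shows "\<exists>i<L. bit u i \<noteq> bit v i"
proof (rule ccontr)
  assume "\<not> ?thesis"
  then have "take_bit L u = take_bit L v"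
    by (intro bit_eqI) (auto simp: bit_take_bit_iff)
  then show False using assms by (simp add: take_bit_nat_eq_self)
qed

text \<open>The bound \<open>4 ^ k\<close> on \<open>n\<close> gives room for the vertices in the
  plane over the field of order \<open>2 ^ k\<close>, and \<open>2 ^ L\<close> makes
  \<open>L\<close> digits enough to separate them. There is one colour for each pair of a digit
  position and a field element.\<close>

lemma avoiding_partition_exists:
  assumes k: "k > 0" "n \<le> 4 ^ k" and L: "n \<le> 2 ^ L"
  shows "\<exists>P. avoiding_bipartite_partition {C4} (complete_graph n) (L * 2 ^ k) P"
proof -
  define F :: "bit alg_closure set" where "F = {x. x ^ (2 ^ k) = x}"
  have card: "card F = 2 ^ k"
    unfolding F_def by (rule card_frobenius_fixed[OF k(1)])
  then have fin: "finite F" by (metis card.infinite power_not_zero zero_neq_numeral)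
  have F_add: "x + y \<in> F" if "x \<in> F" "y \<in> F" for x y
    using that by (simp add: F_def frobenius_add)
  have F_mult: "x * y \<in> F" if "x \<in> F" "y \<in> F" for x y
    using that by (simp add: F_def power_mult_distrib)
  have "card {..<n} \<le> card (F \<times> F)"
    using k(2) by (simp add: card card_cartesian_product flip: power_mult_distrib)
  then obtain z where z: "inj_on z {..<n}" "z ` {..<n} \<subseteq> F \<times> F"
    using card_le_inj[of "{..<n}" "F \<times> F"] fin by auto
  define x y where "x u = fst (z u)" and "y u = snd (z u)" for u
  have xy: "x u \<in> F" "y u \<in> F" if "u < n" for u
    using subsetD[OF z(2) imageI[of u]] that by (auto simp: x_def y_def mem_Times_iff)
  have z_inj: "u = v" if "x u = x v" "y u = y v" "u < n" "v < n" for u v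
    using z(1) that by (auto simp: x_def y_def inj_on_def prod_eq_iff)
  \<comment> \<open>For \<open>u = v\<close> the value is unspecified; the facts \<open>lev\<close>
    concern distinct vertices, and the cycle argument below uses only the second component of
    \<open>col\<close>.\<close>
  define lev where "lev u v = (LEAST i. bit u i \<noteq> bit v i)" for u v :: nat
  define col where "col u v = (lev u v, y u + y v + x u * x v)" for u v
  have lev: "lev u v < L" "bit u (lev u v) \<noteq> bit v (lev u v)" if uv: "u < n" "v < n" "u \<noteq> v" for u v
  proof -
    obtain i where i: "i < L" "bit u i \<noteq> bit v i"
      using ex_bit_neq[of u v L] uv L by auto
    show "bit u (lev u v) \<noteq> bit v (lev u v)"
      unfolding lev_def by (rule LeastI[of "\<lambda>i. bit u i \<noteq> bit v i"]) (rule i)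
    have "lev u v \<le> i" unfolding lev_def using i(2) by (rule Least_le)
    then show "lev u v < L" using i(1) by simp
  qed
  have "\<exists>P. avoiding_bipartite_partition {C4} (complete_graph n) (card ({..<L} \<times> F)) P"
  proof (rule avoiding_partition_of_colouring[where col = col])
    show "finite ({..<L} \<times> F)" using fin by simp
    show "col u v \<in> {..<L} \<times> F" if "u < n" "v < n" "u \<noteq> v" for u v
      using lev(1)[OF that] xy that by (auto simp: col_def intro!: F_add F_mult)
    show "col u v = col v u" for u v
      by (simp add: col_def lev_def algebra_simps eq_commute)
    show "\<exists>A. \<forall>u<n. \<forall>v<n. u \<noteq> v \<longrightarrow> col u v = t \<longrightarrow> (u \<in> A) \<noteq> (v \<in> A)" for t
      \<comment> \<open>One side consists of the vertices whose digit at the position recorded in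
        the colour is 1.\<close>
      using lev(2) by (intro exI[of _ "{u. bit u (fst t)}"]) (auto simp: col_def)
  next
    fix a b c d
    assume lt: "a < n" "b < n" "c < n" "d < n" and ne: "a \<noteq> c" "b \<noteq> d"
      and "col a b = col b c" "col b c = col c d" "col c d = col d a"
    then have eq: "y a + y b + x a * x b = y b + y c + x b * x c"
      "y b + y c + x b * x c = y c + y d + x c * x d"
      "y c + y d + x c * x d = y d + y a + x d * x a"
      by (auto simp: col_def)
    \<comment> \<open>In the alternating sum of the four colour values around the cycle all
      \<open>y\<close> terms cancel and the products factor.\<close>
    have "(x a - x c) * (x b - x d) =
        (y a + y b + x a * x b) - (y b + y c + x b * x c) +
        ((y c + y d + x c * x d) - (y d + y a + x d * x a))"
      by (simp add: algebra_simps)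
    also have "\<dots> = 0" unfolding eq(1) eq(3) by simp
    finally have "(x a - x c) * (x b - x d) = 0" .
    then consider "x a = x c" | "x b = x d" by auto
    then show False
    proof cases
      case 1
      \<comment> \<open>With equal first coordinates, the equal colours of the two edges at
        \<open>b\<close> force equal second coordinates.\<close>
      then have "y a = y c" using eq(1) by (simp add: algebra_simps)
      then show False using z_inj[of a c] 1 lt ne by blast
    next
      case 2
      then have "y b = y d" using eq(2) by (simp add: algebra_simps)
      then show False using z_inj[of b d] 2 lt ne by blast
    qed
  qed
  then show ?thesis by (simp add: card card_cartesian_product)
qed

section \<open>Choice of the field order and the number of digits\<close>

lemma ex_power_between:
  fixes n b :: nat
  assumes "b \<ge> 2" "n \<ge> 2"
  shows "\<exists>k>0. n \<le> b ^ k \<and> b ^ k < b * n"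
proof -
  define k where "k = (LEAST k. n \<le> b ^ k)"
  have "n \<le> b ^ n" using assms(1) by (simp add: less_exp less_imp_le self_le_ge2_pow)
  then have le: "n \<le> b ^ k" unfolding k_def by (rule LeastI)
  then have "k \<noteq> 0" using assms by (intro notI) simp
  then have k: "k > 0" by simp
  \<comment> \<open>Minimality of \<open>k\<close> ensures that \<open>b ^ k\<close> overshoots
    \<open>n\<close> by less than a factor \<open>b\<close>.\<close>
  then have "\<not> n \<le> b ^ (k - 1)" using not_less_Least[of "k - 1" "\<lambda>k. n \<le> b ^ k"] by (simp add: k_def)
  then have "b * b ^ (k - 1) < b * n" using assms by simp
  then have "b ^ k < b * n" using k by (simp flip: power_Suc)
  with le k show ?thesis by blast
qed

text \<open>The constant 8 is the product of the factors in \<open>2 ^ k \<le> 2 * sqrt n\<close>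
  and \<open>L \<le> 4 * ln n\<close>.\<close>

lemma avoiding_partition_upper_bound:
  assumes n: "n \<ge> 2"
  shows "\<exists>k P. avoiding_bipartite_partition {C4} (complete_graph n) k P \<and>
           real k \<le> 8 * sqrt (real n) * ln (real n)"
proof -
  obtain k where k: "k > 0" "n \<le> 4 ^ k" "4 ^ k < 4 * n"
    using ex_power_between[of 4 n] n by auto
  obtain L where L: "n \<le> 2 ^ L" "2 ^ L < 2 * n"
    using ex_power_between[of 2 n] n by auto
  have "real ((2 ^ k)\<^sup>2) = real (4 ^ k)"
    by (simp add: power2_eq_square flip: power_mult_distrib)
  also have "\<dots> < real (4 * n)" using k(3) by (simp only: of_nat_less_iff)
  finally have "(2 ^ k)\<^sup>2 < (2 * sqrt (real n))\<^sup>2"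
    by (simp add: power_mult_distrib)
  then have q: "2 ^ k \<le> 2 * sqrt (real n)"
    by (intro less_imp_le) (rule power_less_imp_less_base[where n = 2], simp_all)
  \<comment> \<open>This is \<open>ln (1 + x) \<le> x\<close> at \<open>x = -1/2\<close>.\<close>
  have ln2: "1 / 2 \<le> ln (2 :: real)"
    using ln_add_one_self_le_self2[of "-1/2 :: real"] by (simp add: ln_div)
  have "real (2 ^ L) < real (2 * n)" using L(2) by (simp only: of_nat_less_iff)
  then have "ln (2 ^ L) < ln (2 * real n)"
    using n by (subst ln_less_cancel_iff) auto
  then have "real L * ln 2 < ln 2 + ln (real n)"
    using n by (simp add: ln_realpow ln_mult)
  also have "ln 2 \<le> ln (real n)" using n by simp
  finally have "real L * ln 2 \<le> 2 * ln (real n)" by simp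
  moreover have "real L * (1 / 2) \<le> real L * ln 2"
    using ln2 by (intro mult_left_mono) auto
  ultimately have L': "real L \<le> 4 * ln (real n)" by simp
  have "real (L * 2 ^ k) = real L * 2 ^ k" by simp
  also have "\<dots> \<le> (4 * ln (real n)) * (2 * sqrt (real n))"
    using L' q n by (intro mult_mono) auto
  finally have "real (L * 2 ^ k) \<le> 8 * sqrt (real n) * ln (real n)"
    by (simp add: algebra_simps)
  then show ?thesis using avoiding_partition_exists[OF k(1,2) L(1)] by blast
qed

theorem mainTheorem2:
  "\<exists>a b :: real. a > 0 \<and> b > 0 \<and>
     (\<forall>\<^sub>F n :: nat in sequentially.
        a * sqrt (real n) \<le> real (avoiding_index {C4} (complete_graph n)) \<and>
        real (avoiding_index {C4} (complete_graph n)) \<le> b * sqrt (real n) * ln (real n))"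
proof (intro exI conjI)
  show "(1 / 4 :: real) > 0" "(8 :: real) > 0" by simp_all
  show "\<forall>\<^sub>F n :: nat in sequentially.
        1 / 4 * sqrt (real n) \<le> real (avoiding_index {C4} (complete_graph n)) \<and>
        real (avoiding_index {C4} (complete_graph n)) \<le> 8 * sqrt (real n) * ln (real n)"
    using eventually_ge_at_top[of 2]
  proof eventually_elim
    case (elim n)
    let ?Q = "\<lambda>k. \<exists>P. avoiding_bipartite_partition {C4} (complete_graph n) k P"
    obtain k where k: "?Q k" "real k \<le> 8 * sqrt (real n) * ln (real n)"
      using avoiding_partition_upper_bound[OF elim] by blast
    \<comment> \<open>Existence of some partition makes the \<open>LEAST\<close> attained, so the
      lower bound for arbitrary partitions applies to the index itself.\<close>
    have "?Q (avoiding_index {C4} (complete_graph n))"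
      unfolding avoiding_index_def using k(1) by (rule LeastI)
    then have "1 / 4 * sqrt (real n) \<le> real (avoiding_index {C4} (complete_graph n))"
      using avoiding_partition_lower_bound elim by fastforce
    moreover have "avoiding_index {C4} (complete_graph n) \<le> k"
      unfolding avoiding_index_def using k(1) by (rule Least_le)
    ultimately show ?case using k(2) by linarith
  qed
qed

end
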